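(* Let $q$ be a prime power, $n\ge1$ an integer, and let $f(x),g(x),h(x)\in\mathbf{F}_q[x]$ be monic polynomials of degree less than $n$ such that $f(x)$ and $g(x)$ divide $x^n-1$. Assume that $\gcd(h(x)-\beta,\,x^n-1)=1$ for all non-zero $\beta\in\mathbf{F}_q$. Then every nonzero codeword of the quasi-cyclic code $Q_q(f,g,h)\subset\mathbf{F}_q^{2n}$ has symplectic weight at least $$d_q(f,g,h)=\min\Big\{ d([g]),\ d\big([(x^n-1)/\gcd(x^n-1,h)]\big),\ d\big([\mathrm{lcm}(f,\,g/\gcd(g,h))]\big),\ \tfrac1q\big(d([f])+d([\gcd(hf,g)])+(q-1)\,d([\gcd(f,g)])\big)\Big\}.$$
   Context: $R=\mathbf{F}_q[x]/(x^n-1)$ and $[a(x)]$ is the class of $a(x)$ in $R$. A vector $(a_0,\ldots,a_{n-1})\in\mathbf{F}_q^n$ is identified with $[a_0+a_1x+\cdots+a_{n-1}x^{n-1}]\in R$, and $\mathbf{F}_q^{2n}$ is identified with $R^2$ accordingly (first $n$ coordinates, last $n$ coordinates). $Q_q(f,g,h)$ is the $R$-submodule of $R^2$ generated by $([f(x)],[h(x)f(x)])$ and $(0,[g(x)])$. $d([u(x)])$ is the minimum Hamming distance of the cyclic code (ideal of $R$) generated by $[u(x)]$, i.e. the minimum Hamming weight of its nonzero elements, with the convention that it is $+\infty$ if this code is zero. The symplectic weight of $\vec x\in\mathbf{F}_q^{2n}$ is $w_s(\vec x)=\mathrm{card}\{i\in\{1,\ldots,n\}\mid (x_i,x_{n+i})\ne(0,0)\}$.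 *)

theory Defs
  imports
    "Jordan_Normal_Form.VS_Connect"
    "HOL-Algebra.QuotRing"
    "HOL-Computational_Algebra.Polynomial_Factorial"
    "HOL-Library.Cardinality"
    "HOL-Library.Extended_Real"
begin

text \<open>
  The field $\mathbf{F}_q$ is a finite type \<open>'a\<close> with \<open>q = CARD('a)\<close>. The sort \<open>field_gcd\<close>
  is what the library needs for \<open>gcd\<close> and \<open>lcm\<close> on \<open>'a poly\<close>; these are normalised to be monic.
\<close>

definition cyc_ideal :: "nat \<Rightarrow> 'a::field poly set" where
  "cyc_ideal n = PIdl\<^bsub>class_ring\<^esub> (monom 1 n - 1)"

definition cyc_ring :: "nat \<Rightarrow> 'a::field poly set ring" where
  "cyc_ring n = class_ring Quot (cyc_ideal n)"

definition cyc_class :: "nat \<Rightarrow> 'a::field poly \<Rightarrow> 'a poly set" where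
  "cyc_class n a = cyc_ideal n +>\<^bsub>class_ring\<^esub> a"

text \<open>The identification of $\mathbf{F}_q^n$ with the quotient ring; coordinates are indexed
  from 0.\<close>

definition vec_class :: "nat \<Rightarrow> 'a::field vec \<Rightarrow> 'a poly set" where
  "vec_class n v = cyc_class n (\<Sum>i<n. monom (v $ i) i)"

definition cyclic_code :: "nat \<Rightarrow> 'a::field poly \<Rightarrow> 'a vec set" where
  "cyclic_code n u = {v \<in> carrier_vec n. vec_class n v \<in> Idl\<^bsub>cyc_ring n\<^esub> {cyc_class n u}}"

definition hamming_weight :: "'a::zero vec \<Rightarrow> nat" where
  "hamming_weight v = card {i. i < dim_vec v \<and> v $ i \<noteq> 0}"

text \<open>The infimum is a minimum when the code is nonzero; over the empty set it is \<open>\<infinity>\<close>.\<close>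

definition cyc_dist :: "nat \<Rightarrow> 'a::field poly \<Rightarrow> ereal" where
  "cyc_dist n u = (INF v \<in> cyclic_code n u - {0\<^sub>v n}. ereal (real (hamming_weight v)))"

definition self_module :: "'b ring \<Rightarrow> ('b, 'b) module" where
  "self_module R = \<lparr>carrier = carrier R, mult = mult R, one = one R,
     zero = zero R, add = add R, smult = mult R\<rparr>"

definition cyc_ring_sq :: "nat \<Rightarrow> ('a::field poly set, 'a poly set \<times> 'a poly set) module" where
  "cyc_ring_sq n = direct_sum (self_module (cyc_ring n)) (self_module (cyc_ring n))"

definition qc_code :: "nat \<Rightarrow> 'a::field poly \<Rightarrow> 'a poly \<Rightarrow> 'a poly \<Rightarrow> 'a vec set" where
  "qc_code n f g h =
     {x \<in> carrier_vec (2 * n). (vec_class n (vec_first x n), vec_class n (vec_last x n))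
        \<in> LinearCombinations.module.span (cyc_ring n) (cyc_ring_sq n)
             {(cyc_class n f, cyc_class n (h * f)), (\<zero>\<^bsub>cyc_ring n\<^esub>, cyc_class n g)}}"

definition symplectic_weight :: "nat \<Rightarrow> 'a::zero vec \<Rightarrow> nat" where
  "symplectic_weight n x = card {i. i < n \<and> (x $ i, x $ (n + i)) \<noteq> (0, 0)}"

definition qc_bound ::
    "nat \<Rightarrow> 'a::{field_gcd, finite} poly \<Rightarrow> 'a poly \<Rightarrow> 'a poly \<Rightarrow> ereal" where
  "qc_bound n f g h =
     Min {cyc_dist n g,
          cyc_dist n ((monom 1 n - 1) div gcd (monom 1 n - 1) h),
          cyc_dist n (lcm f (g div gcd g h)),
          (cyc_dist n f + cyc_dist n (gcd (h * f) g)
             + ereal (real CARD('a) - 1) * cyc_dist n (gcd f g)) / ereal (real CARD('a))}"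

end

theory Submission
  imports Defs
begin

text \<open>
  Write a codeword as \<open>(u, v)\<close>, where \<open>u = a f\<close> and \<open>v = a h f + b g\<close> in the quotient ring.
  A nonzero pair \<open>(s, t)\<close> over the field with \<open>q\<close> elements is annihilated by exactly one of the
  \<open>q + 1\<close> linear forms \<open>s\<close> and \<open>t - \<beta> s\<close>, so \<open>q\<close> times the symplectic weight of \<open>(u, v)\<close> is the
  Hamming weight of \<open>u\<close> plus the sum of those of all \<open>v - \<beta> u = a (h - \<beta>) f + b g\<close>.
  If none of these words vanishes, each weight is bounded by the distance of a cyclic code
  containing the word, which gives the averaged term of the bound. If one of them vanishes, the
  symplectic weight is the Hamming weight of \<open>u\<close> or of \<open>v\<close>: for \<open>u = 0\<close> the word \<open>v\<close> lies in the
  code of \<open>g\<close>; for \<open>v = 0\<close> the word \<open>u\<close> is divisible by \<open>f\<close> and \<open>g / gcd g h\<close>; for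
  \<open>v = \<beta> u\<close> with \<open>\<beta> \<noteq> 0\<close> coprimality of \<open>h - \<beta>\<close> and \<open>g\<close> puts \<open>u\<close> into the code of \<open>g\<close>.
\<close>

section \<open>The quotient ring\<close>

lemma mem_cyc_ideal_iff: "p \<in> cyc_ideal n \<longleftrightarrow> monom 1 n - 1 dvd p"
  unfolding cyc_ideal_def cgenideal_def by (auto simp: dvd_def mult.commute)

lemma ideal_cyc_ideal: "ideal (cyc_ideal n) class_ring"
  unfolding cyc_ideal_def by (rule cring.cgenideal_ideal[OF class_cring.is_cring]) simp

lemma cring_cyc_ring: "cring (cyc_ring n)"
  unfolding cyc_ring_def
  by (rule ideal.quotient_is_cring[OF ideal_cyc_ideal class_cring.is_cring])

lemma cyc_class_hom: "cyc_class n \<in> Ring.ring_hom class_ring (cyc_ring n)"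
  using ideal.rcos_ring_hom[OF ideal_cyc_ideal]
  unfolding cyc_class_def[abs_def] cyc_ring_def .

lemma cyc_class_closed: "cyc_class n a \<in> carrier (cyc_ring n)"
  using ring_hom_closed[OF cyc_class_hom] by simp

lemma cyc_class_add: "cyc_class n (a + b) = cyc_class n a \<oplus>\<^bsub>cyc_ring n\<^esub> cyc_class n b"
  using ring_hom_add[OF cyc_class_hom] by simp

lemma cyc_class_mult: "cyc_class n (a * b) = cyc_class n a \<otimes>\<^bsub>cyc_ring n\<^esub> cyc_class n b"
  using ring_hom_mult[OF cyc_class_hom] by simp

lemma cyc_class_eq_iff: "cyc_class n a = cyc_class n b \<longleftrightarrow> monom 1 n - 1 dvd a - b"
  using ring.quotient_eq_iff_same_a_r_cos[OF class_ring.ring_axioms ideal_cyc_ideal, of a b n]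
  by (simp add: class_ring_simps cyc_class_def mem_cyc_ideal_iff)

lemma cyc_class_0: "cyc_class n 0 = \<zero>\<^bsub>cyc_ring n\<^esub>"
  using ring_hom_zero[OF cyc_class_hom class_ring.ring_axioms cring.axioms(1)[OF cring_cyc_ring]]
  by simp

lemma carrier_cyc_ring_cases:
  assumes "c \<in> carrier (cyc_ring n)"
  obtains a where "c = cyc_class n a"
  using assms unfolding cyc_ring_def FactRing_simps cyc_class_def by auto

lemma module_self_module:
  assumes "cring R"
  shows "Module.module R (self_module R)"
proof -
  interpret cring R by fact
  show ?thesis
  proof (rule Module.moduleI)
    show "abelian_group (self_module R)"
      unfolding self_module_def
      by (rule abelian_groupI) (auto simp: a_ac intro: l_neg)
  qed (auto simp: self_module_def l_distr r_distr m_assoc intro: cring_axioms)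
qed

lemma module_cyc_ring_sq: "Module.module (cyc_ring n) (cyc_ring_sq n)"
  unfolding cyc_ring_sq_def
  by (intro direct_sum_is_module module_self_module cring_cyc_ring)

lemma cyc_ring_sq_simps [simp]:
  "carrier (cyc_ring_sq n) = carrier (cyc_ring n) \<times> carrier (cyc_ring n)"
  "\<zero>\<^bsub>cyc_ring_sq n\<^esub> = (\<zero>\<^bsub>cyc_ring n\<^esub>, \<zero>\<^bsub>cyc_ring n\<^esub>)"
  "x \<oplus>\<^bsub>cyc_ring_sq n\<^esub> y = (fst x \<oplus>\<^bsub>cyc_ring n\<^esub> fst y, snd x \<oplus>\<^bsub>cyc_ring n\<^esub> snd y)"
  "c \<odot>\<^bsub>cyc_ring_sq n\<^esub> x = (c \<otimes>\<^bsub>cyc_ring n\<^esub> fst x, c \<otimes>\<^bsub>cyc_ring n\<^esub> snd x)"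
  by (simp_all add: cyc_ring_sq_def direct_sum_def self_module_def)

text \<open>The right-hand set is a submodule containing both generators. Ring coefficients are
  lifted to polynomials \<open>a\<close>, \<open>b\<close>, so that the later arguments are
  divisibility arguments in the polynomial ring.\<close>

lemma qc_span_subset:
  fixes f g h :: "'a::field poly"
  shows "LinearCombinations.module.span (cyc_ring n) (cyc_ring_sq n)
      {(cyc_class n f, cyc_class n (h * f)), (\<zero>\<^bsub>cyc_ring n\<^esub>, cyc_class n g)}
    \<subseteq> {(cyc_class n (a * f), cyc_class n (a * h * f + b * g)) | a b. True}"
    (is "LinearCombinations.module.span _ _ ?S \<subseteq> ?N")
proof (rule LinearCombinations.module.span_is_subset[OF module_cyc_ring_sq])
  have "(cyc_class n f, cyc_class n (h * f)) \<in> ?N"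
    by (intro CollectI exI[of _ 1] exI[of _ 0]) simp
  moreover have "(\<zero>\<^bsub>cyc_ring n\<^esub>, cyc_class n g) \<in> ?N"
    by (intro CollectI exI[of _ 0] exI[of _ 1]) (simp add: cyc_class_0)
  ultimately show "?S \<subseteq> ?N" by simp
  show "submodule (cyc_ring n) ?N (cyc_ring_sq n)"
  proof (rule submodule.intro)
    show "?N \<subseteq> carrier (cyc_ring_sq n)"
      by (auto simp: cyc_class_closed)
    show "\<zero>\<^bsub>cyc_ring_sq n\<^esub> \<in> ?N"
      by (intro CollectI exI[of _ 0]) (simp add: cyc_class_0)
  next
    fix v w assume "v \<in> ?N" "w \<in> ?N"
    then obtain a b a' b' where
      "v = (cyc_class n (a * f), cyc_class n (a * h * f + b * g))"
      "w = (cyc_class n (a' * f), cyc_class n (a' * h * f + b' * g))"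
      by blast
    then show "v \<oplus>\<^bsub>cyc_ring_sq n\<^esub> w \<in> ?N"
      by (intro CollectI exI[of _ "a + a'"] exI[of _ "b + b'"])
        (simp add: cyc_class_add[symmetric] algebra_simps)
  next
    fix c :: "'a poly set" and v assume "c \<in> carrier (cyc_ring n)" "v \<in> ?N"
    then obtain d a b where
      "c = cyc_class n d"
      "v = (cyc_class n (a * f), cyc_class n (a * h * f + b * g))"
      by (auto elim: carrier_cyc_ring_cases)
    then show "c \<odot>\<^bsub>cyc_ring_sq n\<^esub> v \<in> ?N"
      by (intro CollectI exI[of _ "d * a"] exI[of _ "d * b"])
        (simp add: cyc_class_mult[symmetric] algebra_simps)
  qed (rule module_cyc_ring_sq)
qed

section \<open>Words as polynomials\<close>

text \<open>The representative of \<open>vec_class\<close> is kept as a polynomial, since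
  divisibility is tested before passing to classes.\<close>

definition vec_poly :: "nat \<Rightarrow> 'a::field vec \<Rightarrow> 'a poly" where
  "vec_poly n v = (\<Sum>i<n. monom (v $ i) i)"

lemma vec_class_eq: "vec_class n v = cyc_class n (vec_poly n v)"
  by (simp add: vec_class_def vec_poly_def)

lemma vec_poly_zero [simp]: "vec_poly n (0\<^sub>v n) = 0"
  by (simp add: vec_poly_def)

lemma vec_poly_minus_smult:
  assumes "u \<in> carrier_vec n" "v \<in> carrier_vec n"
  shows "vec_poly n (v - c \<cdot>\<^sub>v u) = vec_poly n v - Polynomial.smult c (vec_poly n u)"
proof -
  have "Polynomial.smult c (vec_poly n u) = (\<Sum>i<n. monom (c * u $ i) i)"
    by (simp add: vec_poly_def poly_eq_iff coeff_sum sum_distrib_left if_distrib cong: if_cong)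
  then show ?thesis
    using assms by (simp add: vec_poly_def sum_subtractf[symmetric] diff_monom)
qed

lemma cyclic_codeI:
  fixes u :: "'a::field poly"
  assumes "v \<in> carrier_vec n" "u dvd vec_poly n v"
  shows "v \<in> cyclic_code n u"
proof -
  from assms(2) obtain c where "vec_poly n v = u * c" ..
  then have v: "vec_class n v = cyc_class n u \<otimes>\<^bsub>cyc_ring n\<^esub> cyc_class n c"
    by (simp add: vec_class_eq cyc_class_mult)
  have "ring (cyc_ring n :: 'a poly set ring)"
    using cring_cyc_ring by (rule cring.axioms)
  then have "ideal (Idl\<^bsub>cyc_ring n\<^esub> {cyc_class n u}) (cyc_ring n)"
    and "cyc_class n u \<in> Idl\<^bsub>cyc_ring n\<^esub> {cyc_class n u}"
    by (simp_all add: ring.genideal_ideal ring.genideal_self' cyc_class_closed)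
  then show ?thesis
    using assms(1) v by (simp add: cyclic_code_def ideal.I_r_closed cyc_class_closed)
qed

lemma cyc_dist_le:
  assumes "v \<in> carrier_vec n" "v \<noteq> 0\<^sub>v n" "u dvd vec_poly n v"
  shows "cyc_dist n u \<le> ereal (real (hamming_weight v))"
  unfolding cyc_dist_def using assms by (intro INF_lower) (simp add: cyclic_codeI)

lemma cyc_dist_nonneg: "0 \<le> cyc_dist n u"
  unfolding cyc_dist_def by (intro INF_greatest) simp

lemma qc_codeE:
  assumes "x \<in> qc_code n f g h"
  obtains a b where "monom 1 n - 1 dvd vec_poly n (vec_first x n) - a * f"
    and "monom 1 n - 1 dvd vec_poly n (vec_last x n) - (a * h * f + b * g)"
proof -
  have "(vec_class n (vec_first x n), vec_class n (vec_last x n))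
      \<in> {(cyc_class n (a * f), cyc_class n (a * h * f + b * g)) | a b. True}"
    using assms qc_span_subset[of n f h g] unfolding qc_code_def by blast
  then show thesis
    using that by (auto simp: vec_class_eq cyc_class_eq_iff)
qed

section \<open>Weights\<close>

text \<open>The symplectic weight with the two halves as separate vectors, ready for comparison with
  their Hamming weights.\<close>

definition pair_weight :: "'a::zero vec \<Rightarrow> 'a vec \<Rightarrow> nat" where
  "pair_weight u v = card {i. i < dim_vec u \<and> (u $ i, v $ i) \<noteq> (0, 0)}"

lemma symplectic_weight_eq:
  assumes "x \<in> carrier_vec (2 * n)"
  shows "symplectic_weight n x = pair_weight (vec_first x n) (vec_last x n)"
proof -
  have "vec_first x n $ i = x $ i" "vec_last x n $ i = x $ (n + i)" if "i < n" for i
    using assms that by (simp_all add: vec_first_def vec_last_def mult_2)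
  then show ?thesis
    unfolding symplectic_weight_def pair_weight_def
    by (intro arg_cong[where f = card]) auto
qed

lemma hamming_weight_le_pair_weight:
  assumes "dim_vec u = dim_vec v"
  shows "hamming_weight u \<le> pair_weight u v" "hamming_weight v \<le> pair_weight u v"
  unfolding hamming_weight_def pair_weight_def using assms by (auto intro!: card_mono)

text \<open>Sums of indicators allow the summations over coordinates and over \<beta> to be
  exchanged.\<close>

lemma hamming_weight_eq_sum: "hamming_weight v = (\<Sum>i<dim_vec v. of_bool (v $ i \<noteq> 0))"
  unfolding hamming_weight_def by (simp add: of_bool_def sum.If_cases lessThan_def Collect_conj_eq)

lemma pair_weight_eq_sum:
  "pair_weight u v = (\<Sum>i<dim_vec u. of_bool ((u $ i, v $ i) \<noteq> (0, 0)))"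
  unfolding pair_weight_def by (simp add: of_bool_def sum.If_cases lessThan_def Collect_conj_eq)

text \<open>For \<open>s = 0\<close> every \<open>t - \<beta> * s\<close> equals \<open>t\<close>.
  Otherwise only \<beta> = \<open>t / s\<close> gives zero, and the other q - 1 values together with
  \<open>s\<close> make q.\<close>

lemma count_nonzero_forms:
  fixes s t :: "'a::{field, finite}"
  shows "of_bool (s \<noteq> 0) + (\<Sum>\<beta>\<in>UNIV. of_bool (t - \<beta> * s \<noteq> 0))
    = CARD('a) * of_bool ((s, t) \<noteq> (0, 0))"
proof (cases "s = 0")
  case False
  then have "{\<beta>. t - \<beta> * s \<noteq> 0} = UNIV - {t / s}"
    by (auto simp: field_simps)
  then have "card {\<beta>. t - \<beta> * s \<noteq> 0} = CARD('a) - 1"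
    by (simp add: card_Diff_singleton)
  moreover have "CARD('a) > 0" by simp
  ultimately show ?thesis
    \<comment> \<open>Without the deletion, simp would turn
      \<open>t - \<beta> * s \<noteq> 0\<close> into a form that no longer matches the cardinality
      above.\<close>
    using False by (simp add: of_bool_def sum.If_cases del: right_minus_eq)
qed simp

lemma pair_weight_average:
  fixes u v :: "'a::{field, finite} vec"
  assumes "u \<in> carrier_vec n" "v \<in> carrier_vec n"
  shows "CARD('a) * pair_weight u v
    = hamming_weight u + (\<Sum>\<beta>\<in>UNIV. hamming_weight (v - \<beta> \<cdot>\<^sub>v u))"
proof -
  have "(\<Sum>\<beta>\<in>UNIV. hamming_weight (v - \<beta> \<cdot>\<^sub>v u))
      = (\<Sum>\<beta>\<in>UNIV. \<Sum>i<n. of_bool (v $ i - \<beta> * u $ i \<noteq> 0))"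
    unfolding hamming_weight_eq_sum using assms by (intro sum.cong) simp_all
  also have "\<dots> = (\<Sum>i<n. \<Sum>\<beta>\<in>UNIV. of_bool (v $ i - \<beta> * u $ i \<noteq> 0))"
    by (rule sum.swap)
  finally show ?thesis
    unfolding hamming_weight_eq_sum[of u] pair_weight_eq_sum sum_distrib_left
      count_nonzero_forms[symmetric]
    using assms by (simp only: carrier_vecD sum.distrib)
qed

section \<open>The weight bound for a nonzero codeword\<close>

theorem proposition4:
  fixes n :: nat and f g h :: "'a::{field_gcd, finite} poly"
  assumes "n \<ge> 1"
    and "lead_coeff f = 1" and "lead_coeff g = 1" and "lead_coeff h = 1"
    and "degree f < n" and "degree g < n" and "degree h < n"
    and "f dvd monom 1 n - 1" and "g dvd monom 1 n - 1"
    and "\<And>\<beta>::'a. \<beta> \<noteq> 0 \<Longrightarrow> gcd (h - [:\<beta>:]) (monom 1 n - 1) = 1"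
  shows "\<forall>x \<in> qc_code n f g h - {0\<^sub>v (2 * n)}.
           ereal (real (symplectic_weight n x)) \<ge> qc_bound n f g h"
proof
  let ?M = "monom 1 n - 1 :: 'a poly"
  fix x assume "x \<in> qc_code n f g h - {0\<^sub>v (2 * n)}"
  then have x: "x \<in> qc_code n f g h" "x \<in> carrier_vec (2 * n)" "x \<noteq> 0\<^sub>v (2 * n)"
    by (auto simp: qc_code_def)
  define u where "u = vec_first x n"
  define v where "v = vec_last x n"
  have carr: "u \<in> carrier_vec n" "v \<in> carrier_vec n"
    by (simp_all add: u_def v_def)
  have uv: "u \<noteq> 0\<^sub>v n \<or> v \<noteq> 0\<^sub>v n"
  proof (rule ccontr)
    assume "\<not> ?thesis"
    moreover have "x = u @\<^sub>v v"
      using x(2) by (simp add: u_def v_def mult_2)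
    ultimately show False
      using x(3) by (auto simp: mult_2)
  qed
  define U where "U = vec_poly n u"
  define V where "V = vec_poly n v"
  obtain a b where U: "?M dvd U - a * f" and V: "?M dvd V - (a * h * f + b * g)"
    using qc_codeE[OF x(1)] unfolding U_def V_def u_def v_def by blast
  \<comment> \<open>A divisor of x^n - 1 cannot distinguish polynomials congruent modulo x^n - 1, so
    divisibility passes between \<open>U\<close>, \<open>V\<close> and their expressions in
    \<open>a\<close> and \<open>b\<close>.\<close>
  have dvd_cong: "d dvd p" if "?M dvd p - q" "d dvd ?M" "d dvd q" for d p q
    using that by (metis diff_add_cancel dvd_add dvd_trans)
  have dvd_cong': "d dvd q" if "?M dvd p - q" "d dvd ?M" "d dvd p" for d p q
    using that dvd_cong[of q p d] by (simp add: dvd_diff_commute)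
  have "f dvd ?M" "g dvd ?M" by fact+
  then have f_dvd_U: "f dvd U"
    by (auto intro: dvd_cong[OF U])
  let ?ws = "ereal (real (pair_weight u v))"
  have dist_u: "cyc_dist n d \<le> ?ws" if "u \<noteq> 0\<^sub>v n" "d dvd U" for d
    using cyc_dist_le[OF carr(1) that(1) that(2)[unfolded U_def]]
      hamming_weight_le_pair_weight(1)[of u v] carr
    by (force intro: order_trans)
  have dist_v: "cyc_dist n d \<le> ?ws" if "v \<noteq> 0\<^sub>v n" "d dvd V" for d
    using cyc_dist_le[OF carr(2) that(1) that(2)[unfolded V_def]]
      hamming_weight_le_pair_weight(2)[of u v] carr
    by (force intro: order_trans)
  let ?avg = "(cyc_dist n f + cyc_dist n (gcd (h * f) g)
     + ereal (real CARD('a) - 1) * cyc_dist n (gcd f g)) / ereal (real CARD('a))"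
  \<comment> \<open>A minimum lies below each of its terms, so bounding one of these by the weight
    suffices.\<close>
  have "cyc_dist n g \<le> ?ws \<or> cyc_dist n (lcm f (g div gcd g h)) \<le> ?ws \<or> ?avg \<le> ?ws"
  proof (cases "u = 0\<^sub>v n \<or> (\<exists>\<beta>. v - \<beta> \<cdot>\<^sub>v u = 0\<^sub>v n)")
    case True
    then consider (u) "u = 0\<^sub>v n"
      | (v) "u \<noteq> 0\<^sub>v n" "v = 0\<^sub>v n"
      | (uv) \<beta> where "u \<noteq> 0\<^sub>v n" "\<beta> \<noteq> 0" "v - \<beta> \<cdot>\<^sub>v u = 0\<^sub>v n"
    proof -
      \<comment> \<open>The value \<beta> = 0 means \<open>v = 0\<close>, so the third case may take
        \<beta> nonzero, as the coprimality hypothesis demands.\<close>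
      have "v = 0\<^sub>v n" if "v - 0 \<cdot>\<^sub>v u = 0\<^sub>v n"
        using that carr by (auto simp: vec_eq_iff)
      then show ?thesis
        using True that by metis
    qed
    then show ?thesis
    proof cases
      case u
      then have "?M dvd a * f"
        using U by (simp add: U_def)
      \<comment> \<open>Since \<open>a * f\<close> vanishes modulo x^n - 1, only
        \<open>b * g\<close> is left of \<open>v\<close>.\<close>
      then have "g dvd (a * f) * h + b * g"
        using \<open>g dvd ?M\<close> by (meson dvd_add dvd_mult2 dvd_trans dvd_triv_right)
      then have "g dvd a * h * f + b * g"
        by (simp add: ac_simps)
      then have "g dvd V"
        by (rule dvd_cong[OF V \<open>g dvd ?M\<close>])
      then show ?thesis
        using dist_v u uv by blast
    next
      case v
      then have "?M dvd 0 - (a * h * f + b * g)"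
        using V by (simp add: V_def)
      then have "g dvd a * h * f + b * g"
        using \<open>g dvd ?M\<close> by (rule dvd_cong') simp
      then have "g dvd h * (a * f)"
        by (simp add: dvd_add_left_iff ac_simps)
      \<comment> \<open>Cancelling the nonzero \<open>gcd g h\<close> leaves a cofactor of
        \<open>h\<close> coprime to that of \<open>g\<close>, so the latter must divide
        \<open>a * f\<close>.\<close>
      moreover have "gcd g h \<noteq> 0"
        using assms(3) by auto
      ultimately have "g div gcd g h dvd (h div gcd g h) * (a * f)"
        by (metis dvd_div_mult dvd_mult_cancel_left dvd_mult_div_cancel gcd_dvd1 gcd_dvd2
            mult.assoc)
      moreover have "coprime (g div gcd g h) (h div gcd g h)"
        using assms(3) by (intro div_gcd_coprime) auto
      ultimately have "g div gcd g h dvd a * f"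
        by (simp add: coprime_dvd_mult_right_iff)
      moreover have "g div gcd g h dvd ?M"
        using \<open>g dvd ?M\<close> by (metis dvd_div_mult_self dvd_mult_left gcd_dvd1)
      ultimately have "g div gcd g h dvd U"
        using dvd_cong[OF U] by blast
      then have "lcm f (g div gcd g h) dvd U"
        using f_dvd_U by simp
      then show ?thesis
        using dist_u v by blast
    next
      case uv
      have "V - Polynomial.smult \<beta> U = 0"
        using uv(3) vec_poly_minus_smult[OF carr, of \<beta>] by (simp add: U_def V_def)
      then have eq: "V = [:\<beta>:] * U" by simp
      \<comment> \<open>In this combination \<open>U\<close> and \<open>V\<close> cancel because
        \<open>V\<close> is \<beta> times \<open>U\<close>.\<close>
      have "?M dvd [:\<beta>:] * (U - a * f) - (V - (a * h * f + b * g))"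
        by (rule dvd_diff[OF dvd_mult[OF U] V])
      also have "[:\<beta>:] * (U - a * f) - (V - (a * h * f + b * g))
          = (h - [:\<beta>:]) * (a * f) + b * g"
        unfolding eq by (simp add: algebra_simps)
      finally have "g dvd (h - [:\<beta>:]) * (a * f) + b * g"
        using \<open>g dvd ?M\<close> dvd_trans by blast
      then have "g dvd (h - [:\<beta>:]) * (a * f)"
        by (simp only: dvd_add_left_iff dvd_triv_right)
      moreover have "coprime g (h - [:\<beta>:])"
        using assms(10)[OF uv(2)] \<open>g dvd ?M\<close>
        by (metis coprime_commute coprime_divisors coprime_iff_gcd_eq_1 dvd_refl)
      ultimately have "g dvd a * f"
        by (simp add: coprime_dvd_mult_right_iff)
      then have "g dvd U"
        by (rule dvd_cong[OF U \<open>g dvd ?M\<close>])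
      then show ?thesis
        using dist_u uv(1) by blast
    qed
  next
    case False
    let ?w = "\<lambda>\<beta>. hamming_weight (v - \<beta> \<cdot>\<^sub>v u)"
    let ?q = "CARD('a)"
    have gcd_dvd_V: "gcd (h * f) g dvd V"
      by (rule dvd_cong[OF V dvd_trans[OF gcd_dvd2 \<open>g dvd ?M\<close>]])
        (intro dvd_add; simp add: mult.assoc)
    then have "gcd f g dvd V"
      by (meson dvd_trans dvd_triv_right gcd_dvd1 gcd_dvd2 gcd_greatest)
    then have "gcd f g dvd vec_poly n (v - \<beta> \<cdot>\<^sub>v u)" for \<beta>
      using f_dvd_U unfolding vec_poly_minus_smult[OF carr] U_def V_def
      by (meson dvd_diff dvd_smult dvd_trans gcd_dvd1)
    then have d3: "cyc_dist n (gcd f g) \<le> ereal (real (?w \<beta>))" for \<beta>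
      using False carr by (intro cyc_dist_le) auto
    have v0: "v - 0 \<cdot>\<^sub>v u = v"
      using carr by (auto simp: vec_eq_iff)
    \<comment> \<open>The word for \<beta> = 0 is \<open>v\<close> itself, divisible even by
      \<open>gcd (h * f) g\<close>. The other q - 1 words are only known to be divisible by
      \<open>gcd f g\<close>, whence the factor q - 1.\<close>
    have d2: "cyc_dist n (gcd (h * f) g) \<le> ereal (real (?w 0))"
      using False carr gcd_dvd_V v0 unfolding V_def by (metis cyc_dist_le)
    have d1: "cyc_dist n f \<le> ereal (real (hamming_weight u))"
      using False carr f_dvd_U unfolding U_def by (intro cyc_dist_le) auto
    have card: "card (UNIV - {0::'a}) = ?q - 1"
      by (simp add: card_Diff_singleton)
    have q: "?q > 0" by simp
    \<comment> \<open>This distance lies between 0 and the weight of an actual word, hence is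
      finite, and its multiple by q - 1 can be computed in the reals.\<close>
    obtain r where r: "cyc_dist n (gcd f g) = ereal r"
      using d3[of 0] cyc_dist_nonneg[of n "gcd f g"] by (cases "cyc_dist n (gcd f g)") auto
    have "(real ?q - 1) * r = (\<Sum>\<beta>\<in>UNIV - {0::'a}. r)"
      using card q by (simp add: of_nat_diff)
    also have "\<dots> \<le> (\<Sum>\<beta>\<in>UNIV - {0}. real (?w \<beta>))"
      using d3 by (intro sum_mono) (simp add: r)
    finally have d3': "ereal (real ?q - 1) * cyc_dist n (gcd f g)
        \<le> ereal (\<Sum>\<beta>\<in>UNIV - {0}. real (?w \<beta>))"
      by (simp add: r)
    have "real ?q * real (pair_weight u v)
        = real (hamming_weight u + (\<Sum>\<beta>\<in>UNIV. ?w \<beta>))"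
      by (simp only: pair_weight_average[OF carr, symmetric] of_nat_mult)
    also have "\<dots> = real (hamming_weight u) + real (?w 0) + (\<Sum>\<beta>\<in>UNIV - {0}. real (?w \<beta>))"
      by (simp add: sum.remove[of UNIV 0])
    finally have "cyc_dist n f + cyc_dist n (gcd (h * f) g)
        + ereal (real ?q - 1) * cyc_dist n (gcd f g) \<le> ereal (real ?q * real (pair_weight u v))"
      using add_mono[OF add_mono[OF d1 d2] d3'] by simp
    then have "?avg \<le> ?ws"
      using q by (subst ereal_divide_le_pos) (auto simp: mult.commute)
    then show ?thesis by blast
  qed
  then have "qc_bound n f g h \<le> ?ws"
    unfolding qc_bound_def by (subst Min_le_iff) auto
  then show "qc_bound n f g h \<le> ereal (real (symplectic_weight n x))"
    by (simp add: symplectic_weight_eq[OF x(2)] u_def v_def)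
qed

end
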